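(* Let $h,\hbar:D\to\mathbb{R}$ be CBFs for the system $\dot x=f(x)+g(x)u$, $x\in D\subseteq\mathbb{R}^n$, $u\in\mathbb{R}^m$, that are parallel, $h(x)+\hbar(x)=b$ on $D$ with $b>0$. Let $\alpha,\overline{\alpha}$ be extended class $\mathcal{K}_\infty$ functions for which the CBF conditions of $h$ and $\hbar$, respectively, hold, and such that $\underline{\eta}(x)\le\overline{\eta}(x)$ for all $x\in D$, where $$\underline{\eta}(x)=-L_fh(x)-\alpha(h(x)),\qquad \overline{\eta}(x)=-L_fh(x)+\overline{\alpha}(b-h(x)).$$ Then for every $x\in D$ and every nominal control $u_0\in\mathbb{R}^m$, the quadratic program $$\min_{u\in\mathbb{R}^m}\tfrac12\|u-u_0\|^2\quad\text{subject to}\quad \underline{\eta}(x)\le L_gh(x)u\le\overline{\eta}(x)$$ has the closed-form solution $$u^*=\begin{cases}u_0,&\text{if }L_gh(x)=0,\\ u_0,&\text{if }\underline{\eta}(x)\le L_gh(x)u_0\le\overline{\eta}(x),\\ u_0+\overline{\psi}(x,u_0),&\text{if }L_gh(x)u_0>\overline{\eta}(x),\\ u_0+\underline{\psi}(x,u_0),&\text{if }L_gh(x)u_0<\underline{\eta}(x),\end{cases}$$ where $$\overline{\psi}(x,u_0)=(L_gh(x))^\top\frac{\overline{\eta}(x)-L_gh(x)u_0}{|L_gh(x)|^2},\qquad \underline{\psi}(x,u_0)=(L_gh(x))^\top\frac{\underline{\eta}(x)-L_gh(x)u_0}{|L_gh(x)|^2}.$$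
   Context: System: $\dot x=f(x)+g(x)u$ with $x\in D\subseteq\mathbb{R}^n$, $f:D\to\mathbb{R}^n$, $g:D\to\mathbb{R}^{n\times m}$, and unbounded input $u\in\mathbb{R}^m$. For continuously differentiable $h:D\to\mathbb{R}$, $L_fh(x)=\nabla h(x)^\top f(x)\in\mathbb{R}$ and $L_gh(x)=\nabla h(x)^\top g(x)$ (a $1\times m$ row vector). $|\cdot|$ and $\|\cdot\|$ denote Euclidean norms. $L_gh$ is allowed to vanish at some points. Extended class $\mathcal{K}_\infty$ function: a continuous strictly increasing $\alpha:\mathbb{R}\to\mathbb{R}$ with $\alpha(0)=0$ and $\alpha(s)\to\pm\infty$ as $s\to\pm\infty$. Barrier function candidate: a continuously differentiable $h:D\to\mathbb{R}$ with $\inf_D h<0<\sup_D h$. Control Barrier Function (CBF): a continuously differentiable $h:D\to\mathbb{R}$ such that for some extended class $\mathcal{K}_\infty$ function $\alpha$ the CBF condition $\sup_{u\in\mathbb{R}^m}[L_fh(x)+L_gh(x)u]\ge-\alpha(h(x))$ holds for all $x\in D$; since $u$ is unbounded this is equivalent to: $L_gh(x)=0\implies L_fh(x)\ge-\alpha(h(x))$. Parallel: a pair of candidates $h,\hbar$ is parallel if there is a constant $b>0$ with $h(x)+\hbar(x)=b$ for all $x\in D$. *)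

theory Defs
  imports "HOL-Analysis.Analysis"
begin

text \<open>
  The state set \<open>D\<close> is not assumed to be open.  Derivatives are therefore taken within \<open>D\<close>, and
  differentiability on \<open>D\<close> includes uniqueness of the gradient, which can fail for general \<open>D\<close>
  and without which \<open>\<nabla>h(x)\<close> would be meaningless.  For open \<open>D\<close> this is ordinary
  differentiability (lemma \<open>gradient_on_open\<close> below).
\<close>

definition has_gradient_on :: "(real ^ 'n) set \<Rightarrow> (real ^ 'n \<Rightarrow> real) \<Rightarrow> real ^ 'n \<Rightarrow> real ^ 'n \<Rightarrow> bool" where
  "has_gradient_on D h x v \<longleftrightarrow> (h has_derivative (\<lambda>y. v \<bullet> y)) (at x within D)"

definition gradient_on :: "(real ^ 'n) set \<Rightarrow> (real ^ 'n \<Rightarrow> real) \<Rightarrow> real ^ 'n \<Rightarrow> real ^ 'n" where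
  "gradient_on D h x = (THE v. has_gradient_on D h x v)"

definition continuously_differentiable_on :: "(real ^ 'n) set \<Rightarrow> (real ^ 'n \<Rightarrow> real) \<Rightarrow> bool" where
  "continuously_differentiable_on D h \<longleftrightarrow>
     (\<forall>x\<in>D. \<exists>!v. has_gradient_on D h x v) \<and> continuous_on D (gradient_on D h)"

lemma gradient_on_open:
  assumes "open D" "x \<in> D"
  shows "has_gradient_on D h x v \<longleftrightarrow> GDERIV h x :> v"
    and "(\<exists>!v. has_gradient_on D h x v) \<longleftrightarrow> h differentiable (at x)"
proof -
  have at: "at x within D = at x"
    using assms by (rule at_within_open[rotated])
  show G: "has_gradient_on D h x v \<longleftrightarrow> GDERIV h x :> v" for v
    unfolding has_gradient_on_def gderiv_def at inner_commute[of v] by (rule refl)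
  show "(\<exists>!v. has_gradient_on D h x v) \<longleftrightarrow> h differentiable (at x)"
  proof
    assume "\<exists>!v. has_gradient_on D h x v"
    then show "h differentiable (at x)"
      unfolding has_gradient_on_def at differentiable_def by blast
  next
    assume "h differentiable (at x)"
    then obtain F where F: "(h has_derivative F) (at x)"
      unfolding differentiable_def by blast
    then have lin: "linear F"
      by (rule has_derivative_linear)
    have "F = (\<lambda>y. adjoint F 1 \<bullet> y)"
      using adjoint_works[OF lin] by (auto simp: inner_commute)
    with F have "has_gradient_on D h x (adjoint F 1)"
      unfolding has_gradient_on_def at by simp
    moreover have "v = w" if "has_gradient_on D h x v" "has_gradient_on D h x w" for v w
    proof -
      have "(\<lambda>y. v \<bullet> y) = (\<lambda>y. w \<bullet> y)"
        using that unfolding has_gradient_on_def at by (rule has_derivative_unique)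
      then show ?thesis
        by (metis vector_eq_rdot)
    qed
    ultimately show "\<exists>!v. has_gradient_on D h x v"
      by blast
  qed
qed

definition lie_f ::
  "(real ^ 'n) set \<Rightarrow> (real ^ 'n \<Rightarrow> real ^ 'n) \<Rightarrow> (real ^ 'n \<Rightarrow> real) \<Rightarrow> real ^ 'n \<Rightarrow> real" where
  "lie_f D f h x = gradient_on D h x \<bullet> f x"

text \<open>
  The row vector \<open>L\<^sub>gh(x)\<close> is represented by a vector in \<open>\<real>\<^sup>m\<close>; its product with the column
  vector \<open>u\<close> is the inner product.
\<close>

definition lie_g ::
  "(real ^ 'n) set \<Rightarrow> (real ^ 'n \<Rightarrow> real ^ 'm ^ 'n) \<Rightarrow> (real ^ 'n \<Rightarrow> real) \<Rightarrow> real ^ 'n \<Rightarrow> real ^ 'm" where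
  "lie_g D g h x = gradient_on D h x v* g x"

definition extended_class_K_infinity :: "(real \<Rightarrow> real) \<Rightarrow> bool" where
  "extended_class_K_infinity \<alpha> \<longleftrightarrow>
     continuous_on UNIV \<alpha> \<and> strict_mono \<alpha> \<and> \<alpha> 0 = 0 \<and>
     filterlim \<alpha> at_top at_top \<and> filterlim \<alpha> at_bot at_bot"

text \<open>Infima and suprema are taken in the extended reals because they may be infinite.\<close>

definition barrier_candidate :: "(real ^ 'n) set \<Rightarrow> (real ^ 'n \<Rightarrow> real) \<Rightarrow> bool" where
  "barrier_candidate D h \<longleftrightarrow>
     continuously_differentiable_on D h \<and>
     (INF x\<in>D. ereal (h x)) < 0 \<and> 0 < (SUP x\<in>D. ereal (h x))"

definition cbf_condition ::
  "(real ^ 'n) set \<Rightarrow> (real ^ 'n \<Rightarrow> real ^ 'n) \<Rightarrow> (real ^ 'n \<Rightarrow> real ^ 'm ^ 'n) \<Rightarrow>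
   (real ^ 'n \<Rightarrow> real) \<Rightarrow> (real \<Rightarrow> real) \<Rightarrow> bool" where
  "cbf_condition D f g h \<alpha> \<longleftrightarrow>
     (\<forall>x\<in>D. (SUP u. ereal (lie_f D f h x + lie_g D g h x \<bullet> u)) \<ge> ereal (- \<alpha> (h x)))"

definition control_barrier_function ::
  "(real ^ 'n) set \<Rightarrow> (real ^ 'n \<Rightarrow> real ^ 'n) \<Rightarrow> (real ^ 'n \<Rightarrow> real ^ 'm ^ 'n) \<Rightarrow>
   (real ^ 'n \<Rightarrow> real) \<Rightarrow> bool" where
  "control_barrier_function D f g h \<longleftrightarrow>
     continuously_differentiable_on D h \<and>
     (\<exists>\<alpha>. extended_class_K_infinity \<alpha> \<and> cbf_condition D f g h \<alpha>)"

definition parallel_with ::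
  "(real ^ 'n) set \<Rightarrow> (real ^ 'n \<Rightarrow> real) \<Rightarrow> (real ^ 'n \<Rightarrow> real) \<Rightarrow> real \<Rightarrow> bool" where
  "parallel_with D h hbar b \<longleftrightarrow>
     barrier_candidate D h \<and> barrier_candidate D hbar \<and> b > 0 \<and> (\<forall>x\<in>D. h x + hbar x = b)"

definition eta_lower ::
  "(real ^ 'n) set \<Rightarrow> (real ^ 'n \<Rightarrow> real ^ 'n) \<Rightarrow> (real ^ 'n \<Rightarrow> real) \<Rightarrow> (real \<Rightarrow> real) \<Rightarrow>
   real ^ 'n \<Rightarrow> real" where
  "eta_lower D f h \<alpha> x = - lie_f D f h x - \<alpha> (h x)"

definition eta_upper ::
  "(real ^ 'n) set \<Rightarrow> (real ^ 'n \<Rightarrow> real ^ 'n) \<Rightarrow> (real ^ 'n \<Rightarrow> real) \<Rightarrow> (real \<Rightarrow> real) \<Rightarrow> real \<Rightarrow>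
   real ^ 'n \<Rightarrow> real" where
  "eta_upper D f h \<alpha>bar b x = - lie_f D f h x + \<alpha>bar (b - h x)"

text \<open>With \<open>l = L\<^sub>gh(x)\<close> and \<open>e\<close> the violated bound, this is both \<open>\<psi>\<close>-corrections.\<close>

definition psi :: "real ^ 'm \<Rightarrow> real \<Rightarrow> real ^ 'm \<Rightarrow> real ^ 'm" where
  "psi l e u0 = ((e - l \<bullet> u0) / (norm l)\<^sup>2) *\<^sub>R l"

definition qp_objective :: "real ^ 'm \<Rightarrow> real ^ 'm \<Rightarrow> real" where
  "qp_objective u0 u = 1 / 2 * (norm (u - u0))\<^sup>2"

definition qp_solution :: "real ^ 'm \<Rightarrow> real \<Rightarrow> real \<Rightarrow> real ^ 'm \<Rightarrow> real ^ 'm" where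
  "qp_solution l lo hi u0 =
     (if l = 0 then u0
      else if lo \<le> l \<bullet> u0 \<and> l \<bullet> u0 \<le> hi then u0
      else if l \<bullet> u0 > hi then u0 + psi l hi u0
      else u0 + psi l lo u0)"

end

theory Submission
  imports Defs
begin

text \<open>
  For a fixed state the admissible controls form a slab \<open>{u. lo \<le> l \<bullet> u \<le> hi}\<close> with
  \<open>l = L\<^sub>gh(x)\<close> and the two bounds \<open>\<eta>\<close>, and the quadratic program asks for the Euclidean projection of \<open>u\<^sub>0\<close> onto it.
  The candidate is identified by the variational inequality of a projection: a feasible \<open>z\<close>
  for which \<open>z - u\<^sub>0\<close> makes a non-obtuse angle with every feasible direction \<open>v - z\<close> is
  the unique nearest point (\<open>arg_min_iff_eq_if_variational_inequality\<close>).  The correction \<open>psi\<close> moves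
  \<open>u\<^sub>0\<close> along the normal \<open>l\<close> until it meets the violated bounding hyperplane; every feasible
  point lies on the far side of that hyperplane, so the inequality holds.

  Where \<open>l = 0\<close> the constraint does not depend on \<open>u\<close>, so the slab is everything or empty,
  and the control barrier conditions exclude the latter.  The condition for \<open>h\<close> yields
  \<open>lo \<le> 0\<close>.  Since the two functions add up to a constant, their Lie derivatives are opposite
  (\<open>gradient_on_parallel\<close>), so the condition for the second function yields \<open>0 \<le> hi\<close>,
  which makes the program feasible.
\<close>

text \<open>
  Expanding the square gives \<open>\<parallel>v - u\<^sub>0\<parallel>\<^sup>2 \<ge> \<parallel>z - u\<^sub>0\<parallel>\<^sup>2 + \<parallel>v - z\<parallel>\<^sup>2\<close> for feasible \<open>v\<close>;
  the second summand makes the minimizer unique.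
\<close>

lemma arg_min_iff_eq_if_variational_inequality:
  fixes z :: "real ^ 'm"
  assumes feasible: "P z"
    and vi: "\<And>v. P v \<Longrightarrow> 0 \<le> (z - u0) \<bullet> (v - z)"
  shows "is_arg_min (qp_objective u0) P u \<longleftrightarrow> u = z"
proof -
  have gap: "qp_objective u0 z + (norm (v - z))\<^sup>2 / 2 \<le> qp_objective u0 v" if "P v" for v
  proof -
    have "(norm (v - u0))\<^sup>2 = (norm (z - u0))\<^sup>2 + (norm (v - z))\<^sup>2 + 2 * ((z - u0) \<bullet> (v - z))"
      unfolding power2_norm_eq_inner by (simp add: inner_diff inner_commute algebra_simps)
    with vi[OF that] show ?thesis
      unfolding qp_objective_def by simp
  qed
  show ?thesis
  proof
    assume "is_arg_min (qp_objective u0) P u"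
    then have "P u" "qp_objective u0 u \<le> qp_objective u0 z"
      using feasible unfolding is_arg_min_def by (auto simp: not_less)
    with gap[of u] have "(norm (u - z))\<^sup>2 \<le> 0"
      by linarith
    then show "u = z"
      by simp
  next
    have "qp_objective u0 z \<le> qp_objective u0 v" if "P v" for v
      using gap[OF that] zero_le_power2[of "norm (v - z)"] by linarith
    moreover assume "u = z"
    ultimately show "is_arg_min (qp_objective u0) P u"
      using feasible unfolding is_arg_min_def by (auto simp: not_less)
  qed
qed

lemma inner_psi_correction:
  assumes "l \<noteq> 0"
  shows "l \<bullet> (u0 + psi l e u0) = e"
  using assms by (simp add: psi_def inner_add_right power2_norm_eq_inner)

text \<open>
  The two hypotheses express feasibility.  For \<open>l \<noteq> 0\<close> the functional \<open>l \<bullet> u\<close> takes every real value,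
  so ordered bounds suffice; for \<open>l = 0\<close> its only value \<open>0\<close> has to lie between them.
\<close>

lemma arg_min_slab_iff:
  fixes l :: "real ^ 'm"
  assumes "lo \<le> hi"
    and degenerate: "l = 0 \<Longrightarrow> lo \<le> 0 \<and> 0 \<le> hi"
  shows "is_arg_min (qp_objective u0) (\<lambda>u. lo \<le> l \<bullet> u \<and> l \<bullet> u \<le> hi) u
    \<longleftrightarrow> u = qp_solution l lo hi u0"
proof -
  let ?P = "\<lambda>u. lo \<le> l \<bullet> u \<and> l \<bullet> u \<le> hi"
  (* The value is nonnegative exactly when the hyperplane on which l takes the value e weakly
     separates u0 from v. *)
  have angle: "(u0 + psi l e u0 - u0) \<bullet> (v - (u0 + psi l e u0))
      = (e - l \<bullet> u0) * (l \<bullet> v - e) / (norm l)\<^sup>2" if "l \<noteq> 0" for e v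
  proof -
    have "(u0 + psi l e u0 - u0) \<bullet> (v - (u0 + psi l e u0))
        = (e - l \<bullet> u0) / (norm l)\<^sup>2 * (l \<bullet> v - l \<bullet> (u0 + psi l e u0))"
      unfolding add_diff_cancel_left' inner_diff_right[symmetric] psi_def by simp
    then show ?thesis
      unfolding inner_psi_correction[OF that] by simp
  qed
  consider (inside) "?P u0" "qp_solution l lo hi u0 = u0"
    | (above) "l \<noteq> 0" "l \<bullet> u0 > hi" "qp_solution l lo hi u0 = u0 + psi l hi u0"
    | (below) "l \<noteq> 0" "l \<bullet> u0 < lo" "qp_solution l lo hi u0 = u0 + psi l lo u0"
    using degenerate \<open>lo \<le> hi\<close> unfolding qp_solution_def
    by (cases "l = 0"; cases "hi < l \<bullet> u0"; cases "l \<bullet> u0 < lo") (auto simp: not_less)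
  then show ?thesis
  proof cases
    case inside
    then show ?thesis
      using arg_min_iff_eq_if_variational_inequality[of ?P u0 u0 u] by simp
  next
    case above
    have "?P (u0 + psi l hi u0)"
      using inner_psi_correction[OF above(1)] \<open>lo \<le> hi\<close> by simp
    moreover have "0 \<le> (u0 + psi l hi u0 - u0) \<bullet> (v - (u0 + psi l hi u0))" if "?P v" for v
      unfolding angle[OF above(1)] using above(2) that
      by (intro divide_nonneg_nonneg mult_nonpos_nonpos) auto
    ultimately show ?thesis
      unfolding above(3) by (rule arg_min_iff_eq_if_variational_inequality)
  next
    case below
    have "?P (u0 + psi l lo u0)"
      using inner_psi_correction[OF below(1)] \<open>lo \<le> hi\<close> by simp
    moreover have "0 \<le> (u0 + psi l lo u0 - u0) \<bullet> (v - (u0 + psi l lo u0))" if "?P v" for v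
      unfolding angle[OF below(1)] using below(2) that
      by (intro divide_nonneg_nonneg mult_nonneg_nonneg) auto
    ultimately show ?thesis
      unfolding below(3) by (rule arg_min_iff_eq_if_variational_inequality)
  qed
qed

lemma has_gradient_on_gradient_on:
  assumes "continuously_differentiable_on D h" "x \<in> D"
  shows "has_gradient_on D h x (gradient_on D h x)"
  using assms unfolding continuously_differentiable_on_def gradient_on_def
  by (blast intro: theI')

text \<open>
  Differentiating \<open>hbar = b - h\<close> within \<open>D\<close> exhibits the negated gradient as \<^emph>\<open>a\<close> gradient of
  \<open>hbar\<close>; on a set that need not be open, uniqueness comes from the differentiability of \<open>hbar\<close>
  on \<open>D\<close>.
\<close>

lemma gradient_on_parallel:
  assumes h: "continuously_differentiable_on D h"
    and hbar: "continuously_differentiable_on D hbar"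
    and sum: "\<forall>y\<in>D. h y + hbar y = b"
    and x: "x \<in> D"
  shows "gradient_on D hbar x = - gradient_on D h x"
proof -
  have "(h has_derivative (\<lambda>y. gradient_on D h x \<bullet> y)) (at x within D)"
    using has_gradient_on_gradient_on[OF h x] unfolding has_gradient_on_def .
  then have "((\<lambda>y. b - h y) has_derivative (\<lambda>y. - gradient_on D h x \<bullet> y)) (at x within D)"
    by (auto intro!: derivative_eq_intros)
  then have "has_gradient_on D hbar x (- gradient_on D h x)"
    unfolding has_gradient_on_def
    by (rule has_derivative_transform[OF x, rotated]) (use sum in force)
  with has_gradient_on_gradient_on[OF hbar x] show ?thesis
    using hbar x unfolding continuously_differentiable_on_def by blast
qed

lemma lie_f_parallel:
  assumes "continuously_differentiable_on D h" "continuously_differentiable_on D hbar"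
    and "\<forall>y\<in>D. h y + hbar y = b" "x \<in> D"
  shows "lie_f D f hbar x = - lie_f D f h x"
  unfolding lie_f_def gradient_on_parallel[OF assms] by simp

lemma lie_g_parallel:
  assumes "continuously_differentiable_on D h" "continuously_differentiable_on D hbar"
    and "\<forall>y\<in>D. h y + hbar y = b" "x \<in> D"
  shows "lie_g D g hbar x = - lie_g D g h x"
  unfolding lie_g_def gradient_on_parallel[OF assms]
  by (simp add: vector_matrix_mult_def vec_eq_iff sum_negf)

lemma lie_f_ge_if_lie_g_eq_0:
  assumes "cbf_condition D f g h \<alpha>" "x \<in> D" "lie_g D g h x = 0"
  shows "- \<alpha> (h x) \<le> lie_f D f h x"
  using assms unfolding cbf_condition_def by force

theorem theorem1:
  fixes D :: "(real ^ 'n) set"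
    and f :: "real ^ 'n \<Rightarrow> real ^ 'n"
    and g :: "real ^ 'n \<Rightarrow> real ^ 'm ^ 'n"
    and h hbar :: "real ^ 'n \<Rightarrow> real"
    and \<alpha> \<alpha>bar :: "real \<Rightarrow> real"
    and b :: real
  assumes "control_barrier_function D f g h"
    and "control_barrier_function D f g hbar"
    and "parallel_with D h hbar b"
    and "extended_class_K_infinity \<alpha>"
    and "extended_class_K_infinity \<alpha>bar"
    and "cbf_condition D f g h \<alpha>"
    and "cbf_condition D f g hbar \<alpha>bar"
    and "\<forall>x\<in>D. eta_lower D f h \<alpha> x \<le> eta_upper D f h \<alpha>bar b x"
  shows "\<forall>x\<in>D. \<forall>u0 :: real ^ 'm. \<forall>u.
           is_arg_min (qp_objective u0)
             (\<lambda>u. eta_lower D f h \<alpha> x \<le> lie_g D g h x \<bullet> u \<and>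
                  lie_g D g h x \<bullet> u \<le> eta_upper D f h \<alpha>bar b x) u
           \<longleftrightarrow> u = qp_solution (lie_g D g h x) (eta_lower D f h \<alpha> x) (eta_upper D f h \<alpha>bar b x) u0"
proof (intro ballI allI)
  fix x u0 u
  assume x: "x \<in> D"
  have diff: "continuously_differentiable_on D h" "continuously_differentiable_on D hbar"
    using assms(1,2) unfolding control_barrier_function_def by auto
  have sum: "\<forall>y\<in>D. h y + hbar y = b"
    using assms(3) unfolding parallel_with_def by blast
  have "eta_lower D f h \<alpha> x \<le> 0 \<and> 0 \<le> eta_upper D f h \<alpha>bar b x" if zero: "lie_g D g h x = 0"
  proof
    show "eta_lower D f h \<alpha> x \<le> 0"
      using lie_f_ge_if_lie_g_eq_0[OF assms(6) x zero] unfolding eta_lower_def by simp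
    have "lie_g D g hbar x = 0"
      using zero lie_g_parallel[OF diff sum x, of g] by simp
    then have "- \<alpha>bar (hbar x) \<le> - lie_f D f h x"
      using lie_f_ge_if_lie_g_eq_0[OF assms(7) x] lie_f_parallel[OF diff sum x, of f] by simp
    moreover have "hbar x = b - h x"
      using sum x by force
    ultimately show "0 \<le> eta_upper D f h \<alpha>bar b x"
      unfolding eta_upper_def by simp
  qed
  then show "is_arg_min (qp_objective u0)
             (\<lambda>u. eta_lower D f h \<alpha> x \<le> lie_g D g h x \<bullet> u \<and>
                  lie_g D g h x \<bullet> u \<le> eta_upper D f h \<alpha>bar b x) u
           \<longleftrightarrow> u = qp_solution (lie_g D g h x) (eta_lower D f h \<alpha> x) (eta_upper D f h \<alpha>bar b x) u0"
    using assms(8) x by (intro arg_min_slab_iff) auto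
qed

end
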